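(* Let $f:\mathbb{R}^n\to\mathbb{R}$ be DC, i.e. $f=g-h$ with convex functions $g,h:\mathbb{R}^n\to\mathbb{R}$, and let $x\in\mathbb{R}^n$. For $n\ge 2$ and $l\in S_{n-1}$ let $f_l:\mathbb{R}^{n-1}\to\mathbb{R}$, $f_l(y):=f'(x;\,l+\Pi_{n-1,l}^{\top}y)$. Then $$\overrightarrow{\partial}_{DC} f(x)=\begin{cases}\left(f'(x;l)\right)_{l=\pm1} & \text{for } n=1,\\[2pt] \left(\overrightarrow{\partial}_{DC} f_l(0),\,f'(x;l)\right)_{l\in S_{n-1}} & \text{for } n\ge 2.\end{cases}$$
   Context: Notation. $S_{n-1}$ is the Euclidean unit sphere of $\mathbb{R}^n$; $\mathcal{C}(\mathbb{R}^n)$ is the family of nonempty convex compact subsets of $\mathbb{R}^n$. For $C\in\mathcal{C}(\mathbb{R}^n)$ and $l\in\mathbb{R}^n$, $\delta^*(l,C):=\max_{c\in C}\langle l,c\rangle$ and $Y(l,C):=\{y\in C:\langle l,y\rangle=\delta^*(l,C)\}$. The (Dini) directional derivative is $f'(x;l):=\lim_{t\downarrow0}\frac{f(x+tl)-f(x)}{t}$. For a convex function $g:\mathbb{R}^n\to\mathbb{R}$, $\partial g(x)=\{s\in\mathbb{R}^n: \langle s,y-x\rangle+g(x)\le g(y)\ \forall y\in\mathbb{R}^n\}$. Rotations and projections. For every $n\ge2$ and $l\in S_{n-1}$ a rotation matrix $R_{n,l}$ of $\mathbb{R}^n$ is fixed once and for all with $R_{n,l}(l)=e^n$ and $R_{n,l}(\mathrm{span}\{l\}^\perp)=\mathrm{span}\{e^1,\dots,e^{n-1}\}$.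 Let $\pi_{n-1,n}\in\mathbb{R}^{(n-1)\times n}$, $\pi_{n-1,n}(x_1,\dots,x_n)=(x_1,\dots,x_{n-1})$, and $\Pi_{n-1,l}:=\pi_{n-1,n}R_{n,l}$. Its transpose $\Pi_{n-1,l}^{\top}=R_{n,l}^{-1}\pi_{n-1,n}^{\top}$ maps $\mathbb{R}^{n-1}$ onto $\mathrm{span}\{l\}^\perp$. Directed sets (recursive definition). A directed set in $\mathbb{R}$ is a pair $\overrightarrow{A}=(a_1(-1),a_1(1))=(a_1(l))_{l=\pm1}\in\mathbb{R}^2$, with norm $\|\overrightarrow{A}\|_1=\max_{l=\pm1}|a_1(l)|$. For $n\ge2$, a directed set in $\mathbb{R}^n$ is $\overrightarrow{A}=(\overrightarrow{A_{n-1}(l)},a_n(l))_{l\in S_{n-1}}$, where $a_n:S_{n-1}\to\mathbb{R}$ is continuous and $\overrightarrow{A_{n-1}}:S_{n-1}\to\mathcal{D}(\mathbb{R}^{n-1})$ is uniformly bounded with respect to $\|\cdot\|_{n-1}$; its norm is $\|\overrightarrow{A}\|_n=\max\{\sup_{l}\|\overrightarrow{A_{n-1}(l)}\|_{n-1},\max_l|a_n(l)|\}$. $\mathcal{D}(\mathbb{R}^n)$ is the set of directed sets in $\mathbb{R}^n$; addition, scalar multiplication and subtraction are defined componentwise (recursively). Embedding. $J_n:\mathcal{C}(\mathbb{R}^n)\to\mathcal{D}(\mathbb{R}^n)$ is given by $J_1([a,b])=(-a,b)$ (entries for $l=-1$ and $l=1$), and for $n\ge2$ by $J_n(A)=\big(J_{n-1}(\Pi_{n-1,l}(Y(l,A))),\delta^*(l,A)\big)_{l\in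 S_{n-1}}$. DC directed subdifferential. For a DC function $f=g-h$ with $g,h:\mathbb{R}^n\to\mathbb{R}$ convex, $\overrightarrow{\partial}_{DC}f(x):=J_n(\partial g(x))-J_n(\partial h(x))$ (independent of the chosen decomposition). *)

theory Defs
  imports "Jordan_Normal_Form.VS_Connect"
begin

text \<open>
  The recursion lowers the dimension, so vectors of \<open>\<real>\<^sup>n\<close> are elements of
  \<open>carrier_vec n :: real vec set\<close>. Components are 0-based: the basis vector \<open>e\<^sup>n\<close> of the
  mathematics is \<open>unit_vec n (n - 1)\<close>. A function on \<open>\<real>\<^sup>n\<close> is a function
  \<open>real vec \<Rightarrow> real\<close> of which only the values on \<open>carrier_vec n\<close> are used.
\<close>

definition euclid_norm :: "real vec \<Rightarrow> real" where
  "euclid_norm v = sqrt (v \<bullet> v)"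

definition unit_sphere :: "nat \<Rightarrow> real vec set" where
  "unit_sphere n = {l \<in> carrier_vec n. euclid_norm l = 1}"

definition continuous_on_sphere :: "nat \<Rightarrow> (real vec \<Rightarrow> real) \<Rightarrow> bool" where
  "continuous_on_sphere n a \<longleftrightarrow>
     (\<forall>l\<in>unit_sphere n. \<forall>\<epsilon>>0. \<exists>\<delta>>0. \<forall>k\<in>unit_sphere n.
        euclid_norm (k - l) < \<delta> \<longrightarrow> \<bar>a k - a l\<bar> < \<epsilon>)"

abbreviation vec_span :: "nat \<Rightarrow> real vec set \<Rightarrow> real vec set" where
  "vec_span n \<equiv> LinearCombinations.module.span class_ring (module_vec TYPE(real) n)"

definition convex_fun :: "nat \<Rightarrow> (real vec \<Rightarrow> real) \<Rightarrow> bool" where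
  "convex_fun n g \<longleftrightarrow>
     (\<forall>u\<in>carrier_vec n. \<forall>v\<in>carrier_vec n. \<forall>t\<in>{0..1}.
        g ((1 - t) \<cdot>\<^sub>v u + t \<cdot>\<^sub>v v) \<le> (1 - t) * g u + t * g v)"

definition dc_decomposition ::
  "nat \<Rightarrow> (real vec \<Rightarrow> real) \<Rightarrow> (real vec \<Rightarrow> real) \<Rightarrow> (real vec \<Rightarrow> real) \<Rightarrow> bool" where
  "dc_decomposition n f g h \<longleftrightarrow>
     convex_fun n g \<and> convex_fun n h \<and> (\<forall>v\<in>carrier_vec n. f v = g v - h v)"

definition dc_fun :: "nat \<Rightarrow> (real vec \<Rightarrow> real) \<Rightarrow> bool" where
  "dc_fun n f \<longleftrightarrow> (\<exists>g h. dc_decomposition n f g h)"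

definition subdifferential :: "nat \<Rightarrow> (real vec \<Rightarrow> real) \<Rightarrow> real vec \<Rightarrow> real vec set" where
  "subdifferential n g x =
     {s \<in> carrier_vec n. \<forall>y\<in>carrier_vec n. s \<bullet> (y - x) + g x \<le> g y}"

definition dir_deriv :: "(real vec \<Rightarrow> real) \<Rightarrow> real vec \<Rightarrow> real vec \<Rightarrow> real" where
  "dir_deriv f x l = Lim (at_right 0) (\<lambda>t. (f (x + t \<cdot>\<^sub>v l) - f x) / t)"

text \<open>
  \<open>GREATEST\<close> is the maximum, which exists for the sets of interest (nonempty and compact).
\<close>

definition support_fun :: "real vec \<Rightarrow> real vec set \<Rightarrow> real" where
  "support_fun l C = (GREATEST r. \<exists>c\<in>C. r = l \<bullet> c)"

definition support_face :: "real vec \<Rightarrow> real vec set \<Rightarrow> real vec set" where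
  "support_face l C = {y \<in> C. l \<bullet> y = support_fun l C}"

definition rotation_mat :: "nat \<Rightarrow> real mat \<Rightarrow> bool" where
  "rotation_mat n M \<longleftrightarrow> M \<in> carrier_mat n n \<and> transpose_mat M * M = 1\<^sub>m n \<and> det M = 1"

definition rotation_family :: "(nat \<Rightarrow> real vec \<Rightarrow> real mat) \<Rightarrow> bool" where
  "rotation_family R \<longleftrightarrow>
     (\<forall>n\<ge>2. \<forall>l\<in>unit_sphere n.
        rotation_mat n (R n l) \<and>
        R n l *\<^sub>v l = unit_vec n (n - 1) \<and>
        (\<lambda>v. R n l *\<^sub>v v) ` vec_module.orthogonal_complement n (vec_span n {l}) =
          vec_span n {unit_vec n i | i. i < n - 1})"

text \<open>
  The index \<open>n\<close> of both matrices below is the dimension of the domain; they map \<open>\<real>\<^sup>n\<close> to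
  \<open>\<real>\<^sup>n\<^sup>-\<^sup>1\<close>.
\<close>

definition drop_last_mat :: "nat \<Rightarrow> real mat" where
  "drop_last_mat n = mat (n - 1) n (\<lambda>(i, j). if i = j then 1 else 0)"

definition proj_mat :: "(nat \<Rightarrow> real vec \<Rightarrow> real mat) \<Rightarrow> nat \<Rightarrow> real vec \<Rightarrow> real mat" where
  "proj_mat R n l = drop_last_mat n * R n l"

text \<open>
  \<open>Directed1 a b\<close> is the pair with entry \<open>a\<close> for \<open>l = -1\<close> and \<open>b\<close> for \<open>l = 1\<close>. \<open>Directed A a\<close>
  is the family of the pairs \<open>(A l, a l)\<close>, where \<open>l\<close> runs through the unit sphere. Dimension and
  regularity are imposed by \<open>directed_sets\<close>; both components are extensional there (\<open>undefined\<close>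
  outside the sphere), so that equality is equality of families indexed by the sphere.
\<close>

datatype directed = Directed1 real real | Directed "real vec \<Rightarrow> directed" "real vec \<Rightarrow> real"

fun directed_norm :: "nat \<Rightarrow> directed \<Rightarrow> real" where
  "directed_norm (Suc 0) (Directed1 a b) = max \<bar>a\<bar> \<bar>b\<bar>"
| "directed_norm (Suc (Suc m)) (Directed A a) =
     max (SUP l\<in>unit_sphere (Suc (Suc m)). directed_norm (Suc m) (A l))
         (SUP l\<in>unit_sphere (Suc (Suc m)). \<bar>a l\<bar>)"
| "directed_norm _ _ = undefined"

fun directed_sets :: "nat \<Rightarrow> directed set" where
  "directed_sets 0 = {}"
| "directed_sets (Suc 0) = {Directed1 a b | a b. True}"
| "directed_sets (Suc (Suc m)) =
     {Directed A a | A a.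
        A \<in> unit_sphere (Suc (Suc m)) \<rightarrow>\<^sub>E directed_sets (Suc m) \<and>
        bdd_above ((\<lambda>l. directed_norm (Suc m) (A l)) ` unit_sphere (Suc (Suc m))) \<and>
        a \<in> extensional (unit_sphere (Suc (Suc m))) \<and>
        continuous_on_sphere (Suc (Suc m)) a}"

fun directed_minus :: "nat \<Rightarrow> directed \<Rightarrow> directed \<Rightarrow> directed" where
  "directed_minus (Suc 0) (Directed1 a b) (Directed1 c d) = Directed1 (a - c) (b - d)"
| "directed_minus (Suc (Suc m)) (Directed A a) (Directed B b) =
     Directed (\<lambda>l\<in>unit_sphere (Suc (Suc m)). directed_minus (Suc m) (A l) (B l))
              (\<lambda>l\<in>unit_sphere (Suc (Suc m)). a l - b l)"
| "directed_minus _ _ _ = undefined"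

text \<open>
  Meaningful for nonempty convex compact \<open>A\<close>. For \<open>n = 1\<close> the set \<open>A\<close> is an interval \<open>[a, b]\<close>
  of one-dimensional vectors, and \<open>Inf\<close> and \<open>Sup\<close> recover its end points.
\<close>

fun directed_embedding ::
  "(nat \<Rightarrow> real vec \<Rightarrow> real mat) \<Rightarrow> nat \<Rightarrow> real vec set \<Rightarrow> directed" where
  "directed_embedding R 0 A = undefined"
| "directed_embedding R (Suc 0) A =
     Directed1 (- (INF v\<in>A. v $ 0)) (SUP v\<in>A. v $ 0)"
| "directed_embedding R (Suc (Suc m)) A =
     Directed
       (\<lambda>l\<in>unit_sphere (Suc (Suc m)).
          directed_embedding R (Suc m)
            ((\<lambda>v. proj_mat R (Suc (Suc m)) l *\<^sub>v v) ` support_face l A))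
       (\<lambda>l\<in>unit_sphere (Suc (Suc m)). support_fun l A)"

text \<open>
  The definite description carries the independence of the chosen decomposition, and the
  condition \<open>D \<in> directed_sets n\<close> that the difference is a directed set: if either failed for
  some \<open>f\<close>, the value at \<open>f\<close> would be unspecified.
\<close>

definition dc_directed_subdiff ::
  "(nat \<Rightarrow> real vec \<Rightarrow> real mat) \<Rightarrow> nat \<Rightarrow> (real vec \<Rightarrow> real) \<Rightarrow> real vec \<Rightarrow> directed" where
  "dc_directed_subdiff R n f x =
     (THE D. D \<in> directed_sets n \<and>
        (\<exists>g h. dc_decomposition n f g h \<and>
           D = directed_minus n (directed_embedding R n (subdifferential n g x))
                                (directed_embedding R n (subdifferential n h x))))"

end

theory Submission
  imports Defs "HOL-Analysis.L2_Norm"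
begin

text \<open>
  For convex \<open>g\<close> the function \<open>\<sigma> = g'(x; \<cdot>)\<close> is sublinear and \<open>\<partial>g(x)\<close> is the set of linear
  functionals below it. Let \<open>l\<close> be a unit vector and \<open>\<Pi>\<close> the projection along \<open>l\<close>. Every
  \<open>t \<in> \<partial>g\<^sub>l(0)\<close>, where \<open>g\<^sub>l(y) = \<sigma>(l + \<Pi>\<^sup>Ty)\<close>, lifts to \<open>s = \<Pi>\<^sup>Tt + \<sigma>(l) l \<in> Y(l, \<partial>g(x))\<close>:
  positive homogeneity gives \<open>\<langle>s, v\<rangle> \<le> \<sigma>(v)\<close> when \<open>\<langle>l, v\<rangle> > 0\<close>, and subadditivity extends this to
  all \<open>v\<close>. Hence \<open>\<Pi> Y(l, \<partial>g(x)) = \<partial>g\<^sub>l(0)\<close>. The same lifting yields, by induction on the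
  dimension, that subgradients exist and that \<open>\<sigma>\<close> is the support function of \<open>\<partial>g(x)\<close>. So the
  difference of the embedded subdifferentials of \<open>g\<close> and \<open>h\<close> satisfies a recursion whose scalar
  component \<open>g'(x; l) - h'(x; l) = f'(x; l)\<close> depends on \<open>f\<close> only, and the decomposition
  \<open>f\<^sub>l = g\<^sub>l - h\<^sub>l\<close> propagates this independence through all dimensions.
\<close>

section \<open>The Euclidean norm\<close>

lemma euclid_norm_eq_L2_set: "euclid_norm v = L2_set (($) v) {0..<dim_vec v}"
  by (simp add: euclid_norm_def L2_set_def scalar_prod_def power2_eq_square)

lemma scalar_prod_le_euclid_norm:
  assumes "u \<in> carrier_vec n" "v \<in> carrier_vec n"
  shows "u \<bullet> v \<le> euclid_norm u * euclid_norm v"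
proof -
  have "u \<bullet> v \<le> (\<Sum>i = 0..<n. \<bar>u $ i\<bar> * \<bar>v $ i\<bar>)"
    using assms by (auto simp: scalar_prod_def abs_mult[symmetric] intro!: sum_mono)
  also have "\<dots> \<le> L2_set (($) u) {0..<n} * L2_set (($) v) {0..<n}"
    by (rule L2_set_mult_ineq)
  finally show ?thesis
    using assms by (simp add: euclid_norm_eq_L2_set)
qed

lemma scalar_prod_self_nonneg: "v \<bullet> (v :: real vec) \<ge> 0"
  by (simp add: scalar_prod_def sum_nonneg)

lemma unit_sphereD:
  assumes "l \<in> unit_sphere n"
  shows "l \<in> carrier_vec n" "l \<bullet> l = 1"
  using assms scalar_prod_self_nonneg[of l] by (auto simp: unit_sphere_def euclid_norm_def)

lemma unit_vec_in_unit_sphere: "i < n \<Longrightarrow> unit_vec n i \<in> unit_sphere n"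
  by (simp add: unit_sphere_def euclid_norm_def)

section \<open>Directional derivatives of convex functions\<close>

definition diff_quotient :: "(real vec \<Rightarrow> real) \<Rightarrow> real vec \<Rightarrow> real vec \<Rightarrow> real \<Rightarrow> real" where
  "diff_quotient f x l t = (f (x + t \<cdot>\<^sub>v l) - f x) / t"

lemma convex_funD:
  assumes "convex_fun n g" "u \<in> carrier_vec n" "v \<in> carrier_vec n" "0 \<le> t" "t \<le> 1"
  shows "g ((1 - t) \<cdot>\<^sub>v u + t \<cdot>\<^sub>v v) \<le> (1 - t) * g u + t * g v"
  using assms by (auto simp: convex_fun_def)

text \<open>The point at step \<open>s\<close> lies on the segment from \<open>x\<close> to the
  point at step \<open>t\<close>, with weight \<open>s / t\<close> on the latter; convexity there is
  the claim after clearing denominators.\<close>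

lemma diff_quotient_mono:
  assumes g: "convex_fun n g" and x: "x \<in> carrier_vec n" and l: "l \<in> carrier_vec n"
    and s: "0 < s" "s \<le> t"
  shows "diff_quotient g x l s \<le> diff_quotient g x l t"
proof -
  have eq: "x + s \<cdot>\<^sub>v l = (1 - s / t) \<cdot>\<^sub>v x + (s / t) \<cdot>\<^sub>v (x + t \<cdot>\<^sub>v l)"
    using x l s by (intro eq_vecI) (auto simp: field_simps)
  have "g (x + s \<cdot>\<^sub>v l) \<le> (1 - s / t) * g x + (s / t) * g (x + t \<cdot>\<^sub>v l)"
    unfolding eq using x l s by (intro convex_funD[OF g]) auto
  then show ?thesis
    using s by (simp add: diff_quotient_def field_simps)
qed

text \<open>Convexity on the segment from \<open>x - l\<close> through \<open>x\<close> to the point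
  at step \<open>s\<close>. The bound is independent of \<open>s\<close>, so the infimum of the
  quotients is finite.\<close>

lemma diff_quotient_lower_bound:
  assumes g: "convex_fun n g" and x: "x \<in> carrier_vec n" and l: "l \<in> carrier_vec n"
    and s: "0 < s"
  shows "g x - g (x - l) \<le> diff_quotient g x l s"
proof -
  \<comment> \<open>The weight of the far end point when \<open>x\<close> is written as a convex
    combination of the two ends, that is, the solution of \<open>c * s = 1 - c\<close>.\<close>
  define c where "c = 1 / (1 + s)"
  have c: "0 \<le> c" "c \<le> 1" "c + c * s = 1" using s by (auto simp: c_def field_simps)
  have coord: "a = (1 - c) * (a - b) + c * (a + s * b)" for a b :: real
  proof -
    have "(1 - c) * (a - b) + c * (a + s * b) = a - b + (c + c * s) * b"
      by (simp add: algebra_simps)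
    then show ?thesis using c(3) by simp
  qed
  have eq: "x = (1 - c) \<cdot>\<^sub>v (x - l) + c \<cdot>\<^sub>v (x + s \<cdot>\<^sub>v l)"
    using x l by (intro eq_vecI) (auto intro: coord)
  have "g x \<le> (1 - c) * g (x - l) + c * g (x + s \<cdot>\<^sub>v l)"
    by (subst eq, rule convex_funD[OF g]) (use x l c in auto)
  also have "1 - c = c * s" using c(3) by simp
  finally have "g x \<le> (s * g (x - l) + g (x + s \<cdot>\<^sub>v l)) / (1 + s)"
    by (simp add: c_def add_divide_distrib)
  then show ?thesis
    using s by (simp add: diff_quotient_def field_simps)
qed

context
  fixes n :: nat and g :: "real vec \<Rightarrow> real" and x :: "real vec"
  assumes g: "convex_fun n g" and x: "x \<in> carrier_vec n"
begin

lemma diff_quotient_bdd_below: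
  assumes "l \<in> carrier_vec n"
  shows "bdd_below (diff_quotient g x l ` {0<..})"
  using diff_quotient_lower_bound[OF g x assms] by (intro bdd_belowI) auto

text \<open>Quotients that decrease with the step and are bounded below tend to their infimum. The
  limit thereby becomes an infimum over all positive steps, and the inequalities for sums and
  multiples of directions are proved from that description.\<close>

lemma diff_quotient_tendsto_INF:
  assumes l: "l \<in> carrier_vec n"
  shows "(diff_quotient g x l \<longlongrightarrow> (INF t\<in>{0<..}. diff_quotient g x l t)) (at_right 0)"
proof (rule decreasing_tendsto)
  show "\<forall>\<^sub>F t in at_right 0. (INF t\<in>{0<..}. diff_quotient g x l t) \<le> diff_quotient g x l t"
    using eventually_at_right_less[of "0::real"]
    by eventually_elim (auto intro!: cINF_lower diff_quotient_bdd_below l)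
next
  fix y assume "(INF t\<in>{0<..}. diff_quotient g x l t) < y"
  then obtain s where s: "0 < s" "diff_quotient g x l s < y"
    by (subst (asm) cINF_less_iff) (auto intro!: diff_quotient_bdd_below l)
  have "\<forall>\<^sub>F t in at_right (0::real). t \<in> {0<..<s}"
    using s(1) by (rule eventually_at_right_real)
  then show "\<forall>\<^sub>F t in at_right 0. diff_quotient g x l t < y"
    by eventually_elim
      (use s diff_quotient_mono[OF g x l] in \<open>auto intro: le_less_trans less_imp_le\<close>)
qed

lemma dir_deriv_eq_INF:
  assumes "l \<in> carrier_vec n"
  shows "dir_deriv g x l = (INF t\<in>{0<..}. diff_quotient g x l t)"
  unfolding dir_deriv_def diff_quotient_def[symmetric]
  by (intro tendsto_Lim diff_quotient_tendsto_INF assms) simp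

lemma diff_quotient_tendsto:
  "l \<in> carrier_vec n \<Longrightarrow> (diff_quotient g x l \<longlongrightarrow> dir_deriv g x l) (at_right 0)"
  using diff_quotient_tendsto_INF by (simp add: dir_deriv_eq_INF)

lemma dir_deriv_le_diff_quotient:
  "l \<in> carrier_vec n \<Longrightarrow> 0 < t \<Longrightarrow> dir_deriv g x l \<le> diff_quotient g x l t"
  by (auto simp: dir_deriv_eq_INF intro!: cINF_lower diff_quotient_bdd_below)

lemma dir_deriv_greatest:
  "l \<in> carrier_vec n \<Longrightarrow> (\<And>t. 0 < t \<Longrightarrow> c \<le> diff_quotient g x l t) \<Longrightarrow> c \<le> dir_deriv g x l"
  by (auto simp: dir_deriv_eq_INF intro!: cINF_greatest)

end

section \<open>Sublinearity of the directional derivative\<close>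

definition sublinear_fun :: "nat \<Rightarrow> (real vec \<Rightarrow> real) \<Rightarrow> bool" where
  "sublinear_fun n p \<longleftrightarrow>
     (\<forall>u\<in>carrier_vec n. \<forall>v\<in>carrier_vec n. p (u + v) \<le> p u + p v) \<and>
     (\<forall>c>0. \<forall>v\<in>carrier_vec n. p (c \<cdot>\<^sub>v v) = c * p v)"

text \<open>The point at step \<open>t\<close> in direction \<open>u + v\<close> is the midpoint of
  the points at step \<open>2 * t\<close> in the directions \<open>u\<close> and
  \<open>v\<close>.\<close>

lemma dir_deriv_add_le:
  assumes g: "convex_fun n g" and x: "x \<in> carrier_vec n"
    and u: "u \<in> carrier_vec n" and v: "v \<in> carrier_vec n"
  shows "dir_deriv g x (u + v) \<le> dir_deriv g x u + dir_deriv g x v"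
proof -
  \<comment> \<open>The steps \<open>s\<close> and \<open>r\<close> are independent, so that the
    infimum can be taken over each of them in turn.\<close>
  have *: "dir_deriv g x (u + v) \<le> diff_quotient g x u s + diff_quotient g x v r"
    if "0 < s" "0 < r" for s r
  proof -
    define t where "t = min s r / 2"
    have t: "0 < t" "2 * t \<le> s" "2 * t \<le> r" using that by (auto simp: t_def)
    have eq: "x + t \<cdot>\<^sub>v (u + v)
        = (1 - 1/2) \<cdot>\<^sub>v (x + (2 * t) \<cdot>\<^sub>v u) + (1/2) \<cdot>\<^sub>v (x + (2 * t) \<cdot>\<^sub>v v)"
      using x u v by (intro eq_vecI) (auto simp: field_simps)
    have "g (x + t \<cdot>\<^sub>v (u + v))
        \<le> (1 - 1/2) * g (x + (2 * t) \<cdot>\<^sub>v u) + (1/2) * g (x + (2 * t) \<cdot>\<^sub>v v)"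
      unfolding eq by (rule convex_funD[OF g]) (use x u v in auto)
    then have "(g (x + t \<cdot>\<^sub>v (u + v)) - g x) / t
        \<le> ((1 - 1/2) * g (x + (2 * t) \<cdot>\<^sub>v u) + (1/2) * g (x + (2 * t) \<cdot>\<^sub>v v) - g x) / t"
      using t by (intro divide_right_mono) auto
    also have "\<dots> = diff_quotient g x u (2 * t) + diff_quotient g x v (2 * t)"
      using t by (simp add: diff_quotient_def field_simps)
    finally have "diff_quotient g x (u + v) t
        \<le> diff_quotient g x u (2 * t) + diff_quotient g x v (2 * t)"
      by (simp add: diff_quotient_def)
    moreover have "dir_deriv g x (u + v) \<le> diff_quotient g x (u + v) t"
      using u v t by (intro dir_deriv_le_diff_quotient[OF g x]) auto
    moreover have "diff_quotient g x u (2 * t) \<le> diff_quotient g x u s"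
      "diff_quotient g x v (2 * t) \<le> diff_quotient g x v r"
      using t u v by (auto intro!: diff_quotient_mono[OF g x])
    ultimately show ?thesis by linarith
  qed
  have "dir_deriv g x (u + v) - dir_deriv g x u \<le> diff_quotient g x v r" if "0 < r" for r
  proof -
    have "dir_deriv g x (u + v) - diff_quotient g x v r \<le> dir_deriv g x u"
      using *[OF _ that] by (intro dir_deriv_greatest[OF g x u]) (auto simp: algebra_simps)
    then show ?thesis by linarith
  qed
  then have "dir_deriv g x (u + v) - dir_deriv g x u \<le> dir_deriv g x v"
    by (intro dir_deriv_greatest[OF g x v])
  then show ?thesis by linarith
qed

text \<open>Rescaling the step by \<open>c\<close> turns the quotients in direction \<open>v\<close>
  into those in direction \<open>c \<cdot>\<^sub>v v\<close>, up to the factor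
  \<open>c\<close>.\<close>

lemma dir_deriv_smult:
  assumes g: "convex_fun n g" and x: "x \<in> carrier_vec n" and v: "v \<in> carrier_vec n"
    and c: "0 < c"
  shows "dir_deriv g x (c \<cdot>\<^sub>v v) = c * dir_deriv g x v"
proof (rule antisym)
  have q: "diff_quotient g x (c \<cdot>\<^sub>v v) t = c * diff_quotient g x v (t * c)" for t
    using c by (simp add: diff_quotient_def smult_smult_assoc)
  have "dir_deriv g x (c \<cdot>\<^sub>v v) / c \<le> diff_quotient g x v t" if "0 < t" for t
  proof -
    have "dir_deriv g x (c \<cdot>\<^sub>v v) \<le> diff_quotient g x (c \<cdot>\<^sub>v v) (t / c)"
      using v c that by (intro dir_deriv_le_diff_quotient[OF g x]) auto
    then show ?thesis using c by (simp add: q field_simps)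
  qed
  from dir_deriv_greatest[OF g x v this]
  show "dir_deriv g x (c \<cdot>\<^sub>v v) \<le> c * dir_deriv g x v"
    using c by (simp add: field_simps)
  show "c * dir_deriv g x v \<le> dir_deriv g x (c \<cdot>\<^sub>v v)"
    using v c dir_deriv_le_diff_quotient[OF g x v]
    by (intro dir_deriv_greatest[OF g x]) (auto simp: q)
qed

lemma sublinear_dir_deriv:
  "convex_fun n g \<Longrightarrow> x \<in> carrier_vec n \<Longrightarrow> sublinear_fun n (dir_deriv g x)"
  by (simp add: sublinear_fun_def dir_deriv_add_le dir_deriv_smult)

text \<open>\<open>Lim\<close> is a total operator, so convergence of the quotients of
  \<open>f\<close> has to be established; it is inherited from those of \<open>g\<close> and
  \<open>h\<close>.\<close>

lemma dir_deriv_dc: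
  assumes dc: "dc_decomposition n f g h" and x: "x \<in> carrier_vec n" and l: "l \<in> carrier_vec n"
  shows "dir_deriv f x l = dir_deriv g x l - dir_deriv h x l"
proof -
  have g: "convex_fun n g" and h: "convex_fun n h"
    and f: "\<And>v. v \<in> carrier_vec n \<Longrightarrow> f v = g v - h v"
    using dc by (auto simp: dc_decomposition_def)
  have "diff_quotient f x l = (\<lambda>t. diff_quotient g x l t - diff_quotient h x l t)"
    using x l by (auto simp: diff_quotient_def f diff_divide_distrib)
  then have "(diff_quotient f x l \<longlongrightarrow> dir_deriv g x l - dir_deriv h x l) (at_right 0)"
    by (simp add: tendsto_diff diff_quotient_tendsto[OF g x l] diff_quotient_tendsto[OF h x l])
  then show ?thesis
    using tendsto_Lim[OF trivial_limit_at_right_real]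
    by (fastforce simp: dir_deriv_def[of f] diff_quotient_def[abs_def])
qed

section \<open>Faces of subdifferentials\<close>

text \<open>For sublinear \<open>p\<close> this is the subdifferential of \<open>p\<close> at the
  origin.\<close>

definition minorants :: "nat \<Rightarrow> (real vec \<Rightarrow> real) \<Rightarrow> real vec set" where
  "minorants n p = {s \<in> carrier_vec n. \<forall>v\<in>carrier_vec n. s \<bullet> v \<le> p v}"

text \<open>A subgradient inequality along a ray, divided by the step, bounds every difference
  quotient and hence their infimum. Conversely, the quotient at step 1 gives back the subgradient
  inequality.\<close>

lemma subdifferential_eq_minorants:
  assumes g: "convex_fun n g" and x: "x \<in> carrier_vec n"
  shows "subdifferential n g x = minorants n (dir_deriv g x)"
proof (intro Set.set_eqI iffI)
  fix s assume s: "s \<in> subdifferential n g x"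
  then have sc: "s \<in> carrier_vec n" by (simp add: subdifferential_def)
  have "s \<bullet> v \<le> dir_deriv g x v" if v: "v \<in> carrier_vec n" for v
  proof (rule dir_deriv_greatest[OF g x v])
    fix t :: real assume t: "0 < t"
    have "x + t \<cdot>\<^sub>v v \<in> carrier_vec n" using x v by auto
    with s have "s \<bullet> (x + t \<cdot>\<^sub>v v - x) + g x \<le> g (x + t \<cdot>\<^sub>v v)"
      unfolding subdifferential_def by blast
    moreover have "x + t \<cdot>\<^sub>v v - x = t \<cdot>\<^sub>v v"
      using x v by (intro eq_vecI) auto
    ultimately show "s \<bullet> v \<le> diff_quotient g x v t"
      using t sc v by (simp add: diff_quotient_def field_simps)
  qed
  with sc show "s \<in> minorants n (dir_deriv g x)" by (simp add: minorants_def)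
next
  fix s assume s: "s \<in> minorants n (dir_deriv g x)"
  have "s \<bullet> (y - x) + g x \<le> g y" if y: "y \<in> carrier_vec n" for y
  proof -
    have yx: "y - x \<in> carrier_vec n" using x y by auto
    have "x + 1 \<cdot>\<^sub>v (y - x) = y" using x y by (intro eq_vecI) auto
    then have "dir_deriv g x (y - x) \<le> g y - g x"
      using dir_deriv_le_diff_quotient[OF g x yx, of 1] by (simp add: diff_quotient_def)
    moreover have "s \<bullet> (y - x) \<le> dir_deriv g x (y - x)"
      using s yx by (simp add: minorants_def)
    ultimately show ?thesis by simp
  qed
  then show "s \<in> subdifferential n g x"
    using s by (simp add: minorants_def subdifferential_def)
qed

text \<open>The matrix \<open>P\<close> gives orthonormal coordinates on the complement of the unit
  vector \<open>l\<close>. Separating this from \<open>proj_mat\<close> admits \<open>m = 0\<close>,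
  where \<open>rotation_family\<close> supplies no matrix.\<close>

definition complement_proj :: "nat \<Rightarrow> real vec \<Rightarrow> real mat \<Rightarrow> bool" where
  "complement_proj m l P \<longleftrightarrow> P \<in> carrier_mat m (Suc m) \<and> P *\<^sub>v l = 0\<^sub>v m \<and>
     (\<forall>y\<in>carrier_vec m. P *\<^sub>v (transpose_mat P *\<^sub>v y) = y) \<and>
     (\<forall>v\<in>carrier_vec (Suc m). transpose_mat P *\<^sub>v (P *\<^sub>v v) + (l \<bullet> v) \<cdot>\<^sub>v l = v)"

text \<open>A sublinear function is convex, and the slice is its composition with an affine
  map.\<close>

lemma convex_fun_slice:
  assumes p: "sublinear_fun k p" and l: "l \<in> carrier_vec k" and P: "P \<in> carrier_mat m k"
  shows "convex_fun m (\<lambda>y. p (l + transpose_mat P *\<^sub>v y))"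
  unfolding convex_fun_def
proof (intro ballI)
  fix u v :: "real vec" and t :: real
  assume u: "u \<in> carrier_vec m" and v: "v \<in> carrier_vec m" and t: "t \<in> {0..1}"
  let ?a = "\<lambda>y. l + transpose_mat P *\<^sub>v y"
  have a: "?a u \<in> carrier_vec k" "?a v \<in> carrier_vec k"
    using l P u v by auto
  have "transpose_mat P *\<^sub>v ((1 - t) \<cdot>\<^sub>v u + t \<cdot>\<^sub>v v)
      = (1 - t) \<cdot>\<^sub>v (transpose_mat P *\<^sub>v u) + t \<cdot>\<^sub>v (transpose_mat P *\<^sub>v v)"
    using P u v by (simp add: mult_add_distrib_mat_vec[of _ k m] mult_mat_vec[of _ k m])
  also have "l + \<dots> = (1 - t) \<cdot>\<^sub>v ?a u + t \<cdot>\<^sub>v ?a v"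
    using l P by (intro eq_vecI) (auto simp: algebra_simps)
  finally have eq: "?a ((1 - t) \<cdot>\<^sub>v u + t \<cdot>\<^sub>v v) = (1 - t) \<cdot>\<^sub>v ?a u + t \<cdot>\<^sub>v ?a v" .
  \<comment> \<open>The end points are treated apart because \<open>sublinear_fun\<close> grants
    homogeneity for positive factors only.\<close>
  consider "t = 0" | "t = 1" | "0 < t" "t < 1" using t by fastforce
  then show "p (?a ((1 - t) \<cdot>\<^sub>v u + t \<cdot>\<^sub>v v)) \<le> (1 - t) * p (?a u) + t * p (?a v)"
  proof cases
    case 1
    moreover have "1 \<cdot>\<^sub>v u + 0 \<cdot>\<^sub>v v = u" using u v by (intro eq_vecI) auto
    ultimately show ?thesis by simp
  next
    case 2
    moreover have "0 \<cdot>\<^sub>v u + 1 \<cdot>\<^sub>v v = v" using u v by (intro eq_vecI) auto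
    ultimately show ?thesis by simp
  next
    case 3
    have "p ((1 - t) \<cdot>\<^sub>v ?a u + t \<cdot>\<^sub>v ?a v) \<le> p ((1 - t) \<cdot>\<^sub>v ?a u) + p (t \<cdot>\<^sub>v ?a v)"
      using p a by (simp add: sublinear_fun_def)
    also have "\<dots> = (1 - t) * p (?a u) + t * p (?a v)"
      using p a 3 by (simp add: sublinear_fun_def)
    finally show ?thesis by (simp add: eq)
  qed
qed

text \<open>This drives the recursion on the dimension. All elements of the face have the same
  component \<open>p l\<close> along \<open>l\<close>, so each is recovered from its projection; the
  lifting shows that every subgradient of the slice arises in this way.\<close>

lemma subdifferential_slice:
  assumes p: "sublinear_fun (Suc m) p" and l: "l \<in> unit_sphere (Suc m)"
    and P: "complement_proj m l P"
  shows "subdifferential m (\<lambda>y. p (l + transpose_mat P *\<^sub>v y)) (0\<^sub>v m)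
    = (\<lambda>s. P *\<^sub>v s) ` {s \<in> minorants (Suc m) p. l \<bullet> s = p l}"
    (is "?D = ?I")
proof (intro Set.set_eqI iffI)
  let ?V = "carrier_vec (Suc m) :: real vec set"
  have lc: "l \<in> ?V" and ll: "l \<bullet> l = 1" using unit_sphereD[OF l] by auto
  have Pc: "P \<in> carrier_mat m (Suc m)" and Pl: "P *\<^sub>v l = 0\<^sub>v m"
    and PPt: "\<And>y. y \<in> carrier_vec m \<Longrightarrow> P *\<^sub>v (transpose_mat P *\<^sub>v y) = y"
    and dec: "\<And>v. v \<in> ?V \<Longrightarrow> transpose_mat P *\<^sub>v (P *\<^sub>v v) + (l \<bullet> v) \<cdot>\<^sub>v l = v"
    using P by (auto simp: complement_proj_def)
  have Ptc: "transpose_mat P *\<^sub>v y \<in> ?V" if "y \<in> carrier_vec m" for y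
    using Pc that by auto
  have adj: "(transpose_mat P *\<^sub>v y) \<bullet> v = y \<bullet> (P *\<^sub>v v)"
    if "y \<in> carrier_vec m" "v \<in> ?V" for y v
    using transpose_vec_mult_scalar[OF Pc that(2,1)] .
  have P0: "transpose_mat P *\<^sub>v 0\<^sub>v m = 0\<^sub>v (Suc m)"
    using Pc by (intro eq_vecI) (auto simp: scalar_prod_def)
  have add: "p (u + v) \<le> p u + p v" if "u \<in> ?V" "v \<in> ?V" for u v
    using p that by (simp add: sublinear_fun_def)
  have hom: "p (c \<cdot>\<^sub>v v) = c * p v" if "0 < c" "v \<in> ?V" for c v
    using p that by (simp add: sublinear_fun_def)
  {
    \<comment> \<open>Projections of face elements are subgradients: \<open>P\<close> is adjoint to
      its transpose, and the face condition supplies the constant \<open>p l\<close>.\<close>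
    fix t assume "t \<in> ?I"
    then obtain s where s: "s \<in> minorants (Suc m) p" "l \<bullet> s = p l" and ts: "t = P *\<^sub>v s"
      by auto
    have sc: "s \<in> ?V" using s by (simp add: minorants_def)
    have "t \<bullet> y + p l \<le> p (l + transpose_mat P *\<^sub>v y)" if y: "y \<in> carrier_vec m" for y
    proof -
      have "s \<bullet> (l + transpose_mat P *\<^sub>v y) = s \<bullet> l + s \<bullet> (transpose_mat P *\<^sub>v y)"
        using sc lc Ptc[OF y] by (simp add: scalar_prod_add_distrib)
      also have "s \<bullet> l = p l" using s comm_scalar_prod[OF sc lc] by simp
      also have "s \<bullet> (transpose_mat P *\<^sub>v y) = (transpose_mat P *\<^sub>v y) \<bullet> s"
        using comm_scalar_prod[OF sc Ptc[OF y]] .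
      also have "\<dots> = y \<bullet> t" using adj[OF y sc] ts by simp
      also have "\<dots> = t \<bullet> y"
        using comm_scalar_prod[of y m t] y ts Pc sc by simp
      finally have "s \<bullet> (l + transpose_mat P *\<^sub>v y) = p l + t \<bullet> y" .
      moreover have "s \<bullet> (l + transpose_mat P *\<^sub>v y) \<le> p (l + transpose_mat P *\<^sub>v y)"
        using s lc Ptc[OF y] by (simp add: minorants_def)
      ultimately show ?thesis by simp
    qed
    moreover have "t \<in> carrier_vec m" using ts Pc sc by simp
    moreover have "y - 0\<^sub>v m = y" if "y \<in> carrier_vec m" for y :: "real vec" using that by auto
    moreover have "l + 0\<^sub>v (Suc m) = l" using lc by simp
    ultimately show "t \<in> ?D"
      by (simp add: subdifferential_def P0)
  }
  fix t assume t: "t \<in> ?D"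
  then have tc: "t \<in> carrier_vec m" by (simp add: subdifferential_def)
  have slice: "t \<bullet> y + p l \<le> p (l + transpose_mat P *\<^sub>v y)" if y: "y \<in> carrier_vec m" for y
  proof -
    have "y - 0\<^sub>v m = y" "l + 0\<^sub>v (Suc m) = l" using y lc by auto
    then show ?thesis using t y by (auto simp: subdifferential_def P0)
  qed
  \<comment> \<open>The lift of \<open>t\<close>; its component along \<open>l\<close> is chosen to
    put it into the face.\<close>
  define s where "s = transpose_mat P *\<^sub>v t + p l \<cdot>\<^sub>v l"
  have sc: "s \<in> ?V" using Ptc[OF tc] lc by (simp add: s_def)
  have sv: "s \<bullet> v = t \<bullet> (P *\<^sub>v v) + p l * (l \<bullet> v)" if "v \<in> ?V" for v
    using that tc lc Ptc[OF tc] adj[OF tc that]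
    by (simp add: s_def add_scalar_prod_distrib[of _ "Suc m"])
  have sl: "s \<bullet> l = p l" using sv[OF lc] tc by (simp add: Pl ll)
  \<comment> \<open>Dividing \<open>v\<close> by \<open>l \<bullet> v\<close> moves it into the
    affine hyperplane parametrised by the slice, where the inequality for \<open>t\<close> applies;
    homogeneity scales back.\<close>
  have pos: "s \<bullet> v \<le> p v" if v: "v \<in> ?V" and lv: "0 < l \<bullet> v" for v
  proof -
    define a where "a = l \<bullet> v"
    have a: "0 < a" using lv by (simp add: a_def)
    have Pv: "P *\<^sub>v v \<in> carrier_vec m" using Pc v by simp
    have "transpose_mat P *\<^sub>v ((1 / a) \<cdot>\<^sub>v (P *\<^sub>v v)) = (1 / a) \<cdot>\<^sub>v (transpose_mat P *\<^sub>v (P *\<^sub>v v))"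
      using Pc Pv by (intro mult_mat_vec[of _ "Suc m" m]) auto
    moreover have "a \<cdot>\<^sub>v (l + (1 / a) \<cdot>\<^sub>v w) = w + a \<cdot>\<^sub>v l" if "w \<in> ?V" for w
      using lc that a by (intro eq_vecI) (auto simp: field_simps)
    ultimately have "a \<cdot>\<^sub>v (l + transpose_mat P *\<^sub>v ((1 / a) \<cdot>\<^sub>v (P *\<^sub>v v)))
        = transpose_mat P *\<^sub>v (P *\<^sub>v v) + a \<cdot>\<^sub>v l"
      using Ptc[OF Pv] by simp
    also have "\<dots> = v" using dec[OF v] by (simp add: a_def)
    finally have eq: "a \<cdot>\<^sub>v (l + transpose_mat P *\<^sub>v ((1 / a) \<cdot>\<^sub>v (P *\<^sub>v v))) = v" .
    have "s \<bullet> v = a * (t \<bullet> ((1 / a) \<cdot>\<^sub>v (P *\<^sub>v v)) + p l)"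
      using a tc Pv by (simp add: sv[OF v] a_def[symmetric] field_simps)
    also have "\<dots> \<le> a * p (l + transpose_mat P *\<^sub>v ((1 / a) \<cdot>\<^sub>v (P *\<^sub>v v)))"
      using slice[of "(1 / a) \<cdot>\<^sub>v (P *\<^sub>v v)"] Pv a by simp
    also have "\<dots> = p v"
      using hom[OF a, of "l + transpose_mat P *\<^sub>v ((1 / a) \<cdot>\<^sub>v (P *\<^sub>v v))"] lc Pv Ptc eq by simp
    finally show ?thesis .
  qed
  have "s \<bullet> v \<le> p v" if v: "v \<in> ?V" for v
  proof -
    \<comment> \<open>Adding \<open>b \<cdot>\<^sub>v l\<close> moves \<open>v\<close> into the open
      half-space just treated. Since \<open>s \<bullet> l = p l\<close>, the added term contributes
      \<open>b * p l\<close> on both sides and cancels.\<close>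
    define b where "b = 1 + \<bar>l \<bullet> v\<bar>"
    have b: "0 < b" "0 < l \<bullet> v + b" by (auto simp: b_def)
    have bl: "b \<cdot>\<^sub>v l \<in> ?V" using lc by simp
    have "0 < l \<bullet> (v + b \<cdot>\<^sub>v l)"
      using b by (simp add: scalar_prod_add_distrib[OF lc v bl] scalar_prod_smult_distrib[OF lc lc] ll)
    then have "s \<bullet> (v + b \<cdot>\<^sub>v l) \<le> p (v + b \<cdot>\<^sub>v l)"
      using v bl by (intro pos) auto
    also have "\<dots> \<le> p v + b * p l"
      using add[OF v bl] hom[OF b(1) lc] by simp
    finally show ?thesis
      by (simp add: scalar_prod_add_distrib[OF sc v bl] scalar_prod_smult_distrib[OF sc lc] sl)
  qed
  then have "s \<in> minorants (Suc m) p" using sc by (simp add: minorants_def)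
  moreover have "l \<bullet> s = p l" using sl comm_scalar_prod[OF sc lc] by simp
  moreover have "p l \<cdot>\<^sub>v 0\<^sub>v m = 0\<^sub>v m" by (intro eq_vecI) auto
  then have "P *\<^sub>v s = t"
    using Pc lc tc Ptc[OF tc]
    by (simp add: s_def mult_add_distrib_mat_vec[OF Pc] mult_mat_vec[OF Pc] PPt Pl)
  ultimately show "t \<in> ?I" by blast
qed

section \<open>The projections along the rotated coordinates\<close>

lemma drop_last_mat_carrier: "drop_last_mat (Suc k) \<in> carrier_mat k (Suc k)"
  by (simp add: drop_last_mat_def)

lemma drop_last_mat_mult_vec:
  assumes "v \<in> carrier_vec (Suc k)"
  shows "drop_last_mat (Suc k) *\<^sub>v v = vec k (\<lambda>i. v $ i)"
proof (intro eq_vecI)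
  fix i assume "i < dim_vec (vec k (\<lambda>i. v $ i))"
  then have i: "i < k" by simp
  then have "row (drop_last_mat (Suc k)) i = unit_vec (Suc k) i"
    by (intro eq_vecI) (auto simp: drop_last_mat_def)
  then show "(drop_last_mat (Suc k) *\<^sub>v v) $ i = vec k (\<lambda>i. v $ i) $ i"
    using i assms drop_last_mat_carrier[of k] by simp
qed (use drop_last_mat_carrier[of k] in auto)

lemma transpose_drop_last_mat_mult_vec:
  assumes "y \<in> carrier_vec k"
  shows "transpose_mat (drop_last_mat (Suc k)) *\<^sub>v y = vec (Suc k) (\<lambda>i. if i < k then y $ i else 0)"
proof (intro eq_vecI)
  fix i assume "i < dim_vec (vec (Suc k) (\<lambda>i. if i < k then y $ i else 0))"
  then have i: "i < Suc k" by simp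
  then have "col (drop_last_mat (Suc k)) i = (if i < k then unit_vec k i else 0\<^sub>v k)"
    by (intro eq_vecI) (auto simp: drop_last_mat_def)
  then show "(transpose_mat (drop_last_mat (Suc k)) *\<^sub>v y) $ i
      = vec (Suc k) (\<lambda>i. if i < k then y $ i else 0) $ i"
    using i assms drop_last_mat_carrier[of k] by simp
qed (use drop_last_mat_carrier[of k] in auto)

text \<open>Dropping the last coordinate has the required properties for the last basis vector;
  conjugating by the orthogonal matrix that sends \<open>l\<close> to this vector transports them to
  \<open>l\<close>.\<close>

lemma complement_proj_proj_mat:
  assumes R: "rotation_family R" and l: "l \<in> unit_sphere (Suc (Suc m))"
  shows "complement_proj (Suc m) l (proj_mat R (Suc (Suc m)) l)"
proof -
  let ?k = "Suc m"
  let ?n = "Suc ?k"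
  define M where "M = R ?n l"
  define D where "D = drop_last_mat ?n"
  let ?e = "unit_vec ?n ?k :: real vec"
  have lc: "l \<in> carrier_vec ?n" using unit_sphereD[OF l] by simp
  have D: "D \<in> carrier_mat ?k ?n" by (simp add: D_def drop_last_mat_carrier)
  have "rotation_mat ?n M" and Ml: "M *\<^sub>v l = ?e"
    using R l by (auto simp: rotation_family_def M_def)
  then have M: "M \<in> carrier_mat ?n ?n" and MtM: "transpose_mat M * M = 1\<^sub>m ?n"
    by (auto simp: rotation_mat_def)
  have MMt: "M * transpose_mat M = 1\<^sub>m ?n"
    using mat_mult_left_right_inverse[OF _ M MtM] M by simp
  have M_Mt: "M *\<^sub>v (transpose_mat M *\<^sub>v v) = v" if "v \<in> carrier_vec ?n" for v
    using M that MMt by (simp flip: assoc_mult_mat_vec[of M ?n ?n "transpose_mat M" ?n])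
  have Mt_M: "transpose_mat M *\<^sub>v (M *\<^sub>v v) = v" if "v \<in> carrier_vec ?n" for v
    using M that MtM by (simp flip: assoc_mult_mat_vec[of "transpose_mat M" ?n ?n M ?n])
  have P: "(D * M) *\<^sub>v v = D *\<^sub>v (M *\<^sub>v v)" if "v \<in> carrier_vec ?n" for v
    using D M that by (rule assoc_mult_mat_vec)
  have Pt: "transpose_mat (D * M) *\<^sub>v y = transpose_mat M *\<^sub>v (transpose_mat D *\<^sub>v y)"
    if "y \<in> carrier_vec ?k" for y
    unfolding transpose_mult[OF D M] using D M that by (intro assoc_mult_mat_vec) auto
  have DDt: "D *\<^sub>v (transpose_mat D *\<^sub>v y) = y" if "y \<in> carrier_vec ?k" for y
    using that by (intro eq_vecI)
      (auto simp: D_def transpose_drop_last_mat_mult_vec drop_last_mat_mult_vec)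
  have DtD: "transpose_mat D *\<^sub>v (D *\<^sub>v w) + (w $ ?k) \<cdot>\<^sub>v ?e = w" if "w \<in> carrier_vec ?n" for w
    using that by (intro eq_vecI)
      (auto simp: D_def transpose_drop_last_mat_mult_vec drop_last_mat_mult_vec less_Suc_eq)
  have "(D * M) *\<^sub>v l = 0\<^sub>v ?k"
    unfolding P[OF lc] Ml by (intro eq_vecI) (auto simp: D_def drop_last_mat_mult_vec)
  moreover have "(D * M) *\<^sub>v (transpose_mat (D * M) *\<^sub>v y) = y" if y: "y \<in> carrier_vec ?k" for y
    using y D M by (simp add: Pt P M_Mt DDt)
  moreover have "transpose_mat (D * M) *\<^sub>v ((D * M) *\<^sub>v v) + (l \<bullet> v) \<cdot>\<^sub>v l = v"
    if v: "v \<in> carrier_vec ?n" for v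
  proof -
    have Mv: "M *\<^sub>v v \<in> carrier_vec ?n" using M v by simp
    \<comment> \<open>With 0-based indices \<open>?k\<close> is the last coordinate, read off by the
      image of \<open>l\<close>; orthogonality of \<open>M\<close> turns it into
      \<open>l \<bullet> v\<close>.\<close>
    have "(M *\<^sub>v v) $ ?k = (M *\<^sub>v l) \<bullet> (M *\<^sub>v v)"
      using Mv by (simp add: Ml)
    also have "\<dots> = l \<bullet> (transpose_mat M *\<^sub>v (M *\<^sub>v v))"
      using transpose_vec_mult_scalar[of "transpose_mat M" ?n ?n "M *\<^sub>v v" l] M Mv lc by simp
    finally have last: "(M *\<^sub>v v) $ ?k = l \<bullet> v" using v by (simp add: Mt_M)
    have Mte: "transpose_mat M *\<^sub>v ?e = l" using Mt_M[OF lc] by (simp add: Ml)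
    have "v = transpose_mat M *\<^sub>v (M *\<^sub>v v)" using v by (simp add: Mt_M)
    also have "M *\<^sub>v v = transpose_mat D *\<^sub>v (D *\<^sub>v (M *\<^sub>v v)) + (l \<bullet> v) \<cdot>\<^sub>v ?e"
      using DtD[OF Mv] last by simp
    also have "transpose_mat M *\<^sub>v \<dots> =
        transpose_mat M *\<^sub>v (transpose_mat D *\<^sub>v (D *\<^sub>v (M *\<^sub>v v))) + (l \<bullet> v) \<cdot>\<^sub>v l"
      using M D Mv Mte
      by (simp add: mult_add_distrib_mat_vec[of _ ?n ?n] mult_mat_vec[of _ ?n ?n])
    finally show ?thesis using D M v by (simp add: Pt P)
  qed
  ultimately show ?thesis
    using D M by (simp add: complement_proj_def proj_mat_def M_def D_def)
qed

lemma complement_proj_exists: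
  assumes R: "rotation_family R" and l: "l \<in> unit_sphere (Suc m)"
  shows "\<exists>P. complement_proj m l P"
proof (cases m)
  case 0
  have l1: "l \<in> carrier_vec 1" "l $ 0 * l $ 0 = 1"
    using unit_sphereD[OF l] 0 by (auto simp: scalar_prod_def)
  \<comment> \<open>In dimension 1 the complement is trivial and the single entry of
    \<open>l\<close> squares to 1, so the empty matrix serves.\<close>
  have "complement_proj 0 l (0\<^sub>m 0 1)"
    using l1 by (auto simp: complement_proj_def scalar_prod_def algebra_simps)
  then show ?thesis using 0 by blast
next
  case (Suc k)
  then show ?thesis using complement_proj_proj_mat[OF R] l by blast
qed

section \<open>Support functions of subdifferentials\<close>

text \<open>Induction in place of a separation argument: the slice is convex in one dimension less,
  and a subgradient of it lifts by \<open>subdifferential_slice\<close>. The family \<open>R\<close>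
  provides the projections.\<close>

lemma subdifferential_nonempty:
  assumes R: "rotation_family R"
  shows "convex_fun n g \<Longrightarrow> x \<in> carrier_vec n \<Longrightarrow> subdifferential n g x \<noteq> {}"
proof (induction n arbitrary: g x)
  case 0
  have "s \<bullet> (y - x) + g x \<le> g y" if "y \<in> carrier_vec 0" for s y
  proof -
    have "y = x" using that 0 by (intro eq_vecI) auto
    then show ?thesis using 0 by (simp add: scalar_prod_def)
  qed
  then have "0\<^sub>v 0 \<in> subdifferential 0 g x" by (simp add: subdifferential_def)
  then show ?case by blast
next
  case (Suc m)
  let ?l = "unit_vec (Suc m) 0 :: real vec"
  have l: "?l \<in> unit_sphere (Suc m)" by (simp add: unit_vec_in_unit_sphere)
  obtain P where P: "complement_proj m ?l P" using complement_proj_exists[OF R l] by blast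
  note p = sublinear_dir_deriv[OF Suc.prems]
  have "convex_fun m (\<lambda>y. dir_deriv g x (?l + transpose_mat P *\<^sub>v y))"
    using P by (intro convex_fun_slice[OF p]) (auto simp: complement_proj_def)
  then have "subdifferential m (\<lambda>y. dir_deriv g x (?l + transpose_mat P *\<^sub>v y)) (0\<^sub>v m) \<noteq> {}"
    by (intro Suc.IH) auto
  then show ?case
    unfolding subdifferential_slice[OF p l P] subdifferential_eq_minorants[OF Suc.prems] by blast
qed

text \<open>Slicing in the prescribed direction \<open>l\<close> makes the lifted subgradient land
  in the face exposed by \<open>l\<close>.\<close>

lemma subdifferential_attains_dir_deriv:
  assumes R: "rotation_family R" and g: "convex_fun n g" and x: "x \<in> carrier_vec n"
    and l: "l \<in> unit_sphere n"
  obtains s where "s \<in> subdifferential n g x" "l \<bullet> s = dir_deriv g x l"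
proof (cases n)
  \<comment> \<open>The unit sphere of dimension 0 is empty, as \<open>l \<bullet> l\<close> is an
    empty sum.\<close>
  case 0
  then show ?thesis using unit_sphereD[OF l] by (auto simp: scalar_prod_def)
next
  case (Suc m)
  obtain P where P: "complement_proj m l P" using complement_proj_exists[OF R] l Suc by blast
  note p = sublinear_dir_deriv[OF g x]
  have "convex_fun m (\<lambda>y. dir_deriv g x (l + transpose_mat P *\<^sub>v y))"
    using P unit_sphereD[OF l] Suc by (intro convex_fun_slice[OF p]) (auto simp: complement_proj_def)
  then have "subdifferential m (\<lambda>y. dir_deriv g x (l + transpose_mat P *\<^sub>v y)) (0\<^sub>v m) \<noteq> {}"
    by (intro subdifferential_nonempty[OF R]) auto
  then obtain s where "s \<in> minorants n (dir_deriv g x)" "l \<bullet> s = dir_deriv g x l"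
    using subdifferential_slice[OF p[unfolded Suc] l[unfolded Suc] P] Suc by auto
  then show ?thesis
    using that subdifferential_eq_minorants[OF g x] by simp
qed

lemma scalar_prod_le_dir_deriv:
  assumes g: "convex_fun n g" and x: "x \<in> carrier_vec n"
    and s: "s \<in> subdifferential n g x" and l: "l \<in> carrier_vec n"
  shows "l \<bullet> s \<le> dir_deriv g x l"
proof -
  have "s \<in> minorants n (dir_deriv g x)" using s subdifferential_eq_minorants[OF g x] by simp
  then show ?thesis using l comm_scalar_prod[of l n s] by (simp add: minorants_def)
qed

lemma support_fun_subdifferential:
  assumes R: "rotation_family R" and g: "convex_fun n g" and x: "x \<in> carrier_vec n"
    and l: "l \<in> unit_sphere n"
  shows "support_fun l (subdifferential n g x) = dir_deriv g x l"
proof -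
  obtain s where s: "s \<in> subdifferential n g x" "l \<bullet> s = dir_deriv g x l"
    by (rule subdifferential_attains_dir_deriv[OF assms])
  show ?thesis
    unfolding support_fun_def
  proof (rule Greatest_equality)
    show "\<exists>c\<in>subdifferential n g x. dir_deriv g x l = l \<bullet> c"
      using s by (intro bexI[of _ s]) auto
  qed (use scalar_prod_le_dir_deriv[OF g x] unit_sphereD[OF l] in auto)
qed

section \<open>Bounds and continuity on the sphere\<close>

text \<open>Testing with plus and minus each basis vector bounds every coordinate of a
  subgradient.\<close>

lemma subdifferential_bounded:
  assumes g: "convex_fun n g" and x: "x \<in> carrier_vec n"
  shows "\<exists>K. \<forall>s\<in>subdifferential n g x. euclid_norm s \<le> K"
proof -
  let ?b = "\<lambda>i. max (dir_deriv g x (unit_vec n i)) (dir_deriv g x (- unit_vec n i))"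
  have "euclid_norm s \<le> (\<Sum>i = 0..<n. ?b i)" if s: "s \<in> subdifferential n g x" for s
  proof -
    have sc: "s \<in> carrier_vec n" using s by (simp add: subdifferential_def)
    have "euclid_norm s \<le> (\<Sum>i = 0..<n. \<bar>s $ i\<bar>)"
      using sc by (simp add: euclid_norm_eq_L2_set L2_set_le_sum_abs)
    also have "\<dots> \<le> (\<Sum>i = 0..<n. ?b i)"
    proof (intro sum_mono)
      fix i assume "i \<in> {0..<n}"
      then show "\<bar>s $ i\<bar> \<le> ?b i"
        using scalar_prod_le_dir_deriv[OF g x s, of "unit_vec n i"]
          scalar_prod_le_dir_deriv[OF g x s, of "- unit_vec n i"] sc
        by (auto simp: uminus_scalar_prod[symmetric] abs_le_iff)
    qed
    finally show ?thesis .
  qed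
  then show ?thesis by blast
qed

text \<open>A subgradient attaining the derivative at \<open>k\<close> is a competitor at
  \<open>l\<close>; the gap is then estimated by Cauchy-Schwarz. Exchanging \<open>k\<close> and
  \<open>l\<close> gives the other side.\<close>

lemma dir_deriv_lipschitz:
  assumes R: "rotation_family R" and g: "convex_fun n g" and x: "x \<in> carrier_vec n"
    and K: "\<forall>s\<in>subdifferential n g x. euclid_norm s \<le> K"
    and k: "k \<in> unit_sphere n" and l: "l \<in> unit_sphere n"
  shows "dir_deriv g x k - dir_deriv g x l \<le> K * euclid_norm (k - l)"
proof -
  obtain s where s: "s \<in> subdifferential n g x" "k \<bullet> s = dir_deriv g x k"
    by (rule subdifferential_attains_dir_deriv[OF R g x k])
  have c: "s \<in> carrier_vec n" "k \<in> carrier_vec n" "l \<in> carrier_vec n"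
    using s unit_sphereD[OF k] unit_sphereD[OF l] by (auto simp: subdifferential_def)
  have "dir_deriv g x k - dir_deriv g x l \<le> k \<bullet> s - l \<bullet> s"
    using s scalar_prod_le_dir_deriv[OF g x s(1) c(3)] by simp
  also have "\<dots> = s \<bullet> (k - l)"
    using c comm_scalar_prod[OF c(1,2)] comm_scalar_prod[OF c(1,3)]
    by (simp add: scalar_prod_minus_distrib)
  also have "\<dots> \<le> euclid_norm s * euclid_norm (k - l)"
    using c by (intro scalar_prod_le_euclid_norm) auto
  also have "\<dots> \<le> K * euclid_norm (k - l)"
    using K s by (intro mult_right_mono) (auto simp: euclid_norm_def scalar_prod_self_nonneg)
  finally show ?thesis .
qed

lemma abs_dir_deriv_le:
  assumes R: "rotation_family R" and g: "convex_fun n g" and x: "x \<in> carrier_vec n"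
    and K: "\<forall>s\<in>subdifferential n g x. euclid_norm s \<le> K" and l: "l \<in> unit_sphere n"
  shows "\<bar>dir_deriv g x l\<bar> \<le> K"
proof -
  obtain s where s: "s \<in> subdifferential n g x" "l \<bullet> s = dir_deriv g x l"
    by (rule subdifferential_attains_dir_deriv[OF R g x l])
  have c: "s \<in> carrier_vec n" "l \<in> carrier_vec n" and l1: "euclid_norm l = 1"
    using s l by (auto simp: subdifferential_def unit_sphere_def)
  have "l \<bullet> s \<le> euclid_norm s" "- (l \<bullet> s) \<le> euclid_norm s"
    using scalar_prod_le_euclid_norm[of l n s] scalar_prod_le_euclid_norm[of "- l" n s] c l1
    by (auto simp: euclid_norm_def uminus_scalar_prod[symmetric])
  then show ?thesis using K s by fastforce
qed

lemma continuous_on_sphere_dir_deriv: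
  assumes R: "rotation_family R" and g: "convex_fun n g" and x: "x \<in> carrier_vec n"
  shows "continuous_on_sphere n (dir_deriv g x)"
  unfolding continuous_on_sphere_def
proof (intro ballI allI impI)
  fix l and e :: real assume l: "l \<in> unit_sphere n" and e: "0 < e"
  obtain K where K: "\<forall>s\<in>subdifferential n g x. euclid_norm s \<le> K"
    using subdifferential_bounded[OF g x] by blast
  \<comment> \<open>Strictly positive even for \<open>K = 0\<close>, so that \<open>e / L\<close> is
    an admissible radius.\<close>
  define L where "L = \<bar>K\<bar> + 1"
  have "\<bar>dir_deriv g x k - dir_deriv g x l\<bar> < e"
    if k: "k \<in> unit_sphere n" and d: "euclid_norm (k - l) < e / L" for k
  proof -
    have nonneg: "0 \<le> euclid_norm (k - l)"
      by (simp add: euclid_norm_def scalar_prod_self_nonneg)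
    have "(k - l) \<bullet> (k - l) = (l - k) \<bullet> (l - k)"
      using unit_sphereD[OF k] unit_sphereD[OF l] by (auto simp: scalar_prod_def algebra_simps)
    then have "\<bar>dir_deriv g x k - dir_deriv g x l\<bar> \<le> K * euclid_norm (k - l)"
      using dir_deriv_lipschitz[OF R g x K k l] dir_deriv_lipschitz[OF R g x K l k]
      by (simp add: euclid_norm_def abs_le_iff)
    also have "\<dots> \<le> L * euclid_norm (k - l)"
      using nonneg by (intro mult_right_mono) (auto simp: L_def)
    also have "\<dots> < e" using d by (simp add: L_def field_simps)
    finally show ?thesis .
  qed
  moreover have "0 < e / L" using e by (simp add: L_def)
  ultimately show "\<exists>d>0. \<forall>k\<in>unit_sphere n. euclid_norm (k - l) < d \<longrightarrow>
      \<bar>dir_deriv g x k - dir_deriv g x l\<bar> < e"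
    by blast
qed

lemma continuous_on_sphere_diff:
  assumes a: "continuous_on_sphere n a" and b: "continuous_on_sphere n b"
  shows "continuous_on_sphere n (\<lambda>l\<in>unit_sphere n. a l - b l)"
  unfolding continuous_on_sphere_def
proof (intro ballI allI impI)
  fix l and e :: real assume l: "l \<in> unit_sphere n" and e: "0 < e"
  obtain d1 where d1: "d1 > 0" "\<forall>k\<in>unit_sphere n. euclid_norm (k - l) < d1 \<longrightarrow> \<bar>a k - a l\<bar> < e / 2"
    using a l e unfolding continuous_on_sphere_def by (meson half_gt_zero)
  obtain d2 where d2: "d2 > 0" "\<forall>k\<in>unit_sphere n. euclid_norm (k - l) < d2 \<longrightarrow> \<bar>b k - b l\<bar> < e / 2"
    using b l e unfolding continuous_on_sphere_def by (meson half_gt_zero)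
  have "\<bar>a k - b k - (a l - b l)\<bar> < e"
    if "k \<in> unit_sphere n" "euclid_norm (k - l) < min d1 d2" for k
  proof -
    have "\<bar>a k - a l\<bar> < e / 2" "\<bar>b k - b l\<bar> < e / 2" using d1 d2 that by auto
    then show ?thesis by linarith
  qed
  moreover have "min d1 d2 > 0" using d1 d2 by simp
  ultimately show "\<exists>d>0. \<forall>k\<in>unit_sphere n. euclid_norm (k - l) < d \<longrightarrow>
      \<bar>(\<lambda>l\<in>unit_sphere n. a l - b l) k - (\<lambda>l\<in>unit_sphere n. a l - b l) l\<bar> < e"
    using l by (intro exI[of _ "min d1 d2"]) auto
qed

section \<open>The directed subdifferential\<close>

abbreviation dir_slice ::
  "(nat \<Rightarrow> real vec \<Rightarrow> real mat) \<Rightarrow> nat \<Rightarrow> (real vec \<Rightarrow> real) \<Rightarrow> real vec \<Rightarrow> real vec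
    \<Rightarrow> real vec \<Rightarrow> real" where
  "dir_slice R n f x l \<equiv> \<lambda>y. dir_deriv f x (l + transpose_mat (proj_mat R n l) *\<^sub>v y)"

lemma proj_mat_carrier:
  assumes "rotation_family R" "l \<in> unit_sphere (Suc (Suc m))"
  shows "proj_mat R (Suc (Suc m)) l \<in> carrier_mat (Suc m) (Suc (Suc m))"
  using complement_proj_proj_mat[OF assms] by (simp add: complement_proj_def)

lemma convex_fun_dir_slice:
  assumes "rotation_family R" "convex_fun (Suc (Suc m)) g" "x \<in> carrier_vec (Suc (Suc m))"
    and "l \<in> unit_sphere (Suc (Suc m))"
  shows "convex_fun (Suc m) (dir_slice R (Suc (Suc m)) g x l)"
  using assms proj_mat_carrier unit_sphereD
  by (intro convex_fun_slice[OF sublinear_dir_deriv]) auto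

text \<open>Passes the DC hypothesis down one dimension; both decompositions of one \<open>f\<close>
  yield decompositions of the same slice.\<close>

lemma dc_decomposition_dir_slice:
  assumes R: "rotation_family R" and dc: "dc_decomposition (Suc (Suc m)) f g h"
    and x: "x \<in> carrier_vec (Suc (Suc m))" and l: "l \<in> unit_sphere (Suc (Suc m))"
  shows "dc_decomposition (Suc m) (dir_slice R (Suc (Suc m)) f x l)
    (dir_slice R (Suc (Suc m)) g x l) (dir_slice R (Suc (Suc m)) h x l)"
  using convex_fun_dir_slice[OF R _ x l] dc proj_mat_carrier[OF R l] unit_sphereD(1)[OF l]
  by (auto simp: dc_decomposition_def intro!: dir_deriv_dc[OF dc x])

text \<open>The sets on which \<open>directed_embedding\<close> recurs are again subdifferentials of
  convex functions.\<close>

lemma subdifferential_dir_slice: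
  assumes R: "rotation_family R" and g: "convex_fun (Suc (Suc m)) g"
    and x: "x \<in> carrier_vec (Suc (Suc m))" and l: "l \<in> unit_sphere (Suc (Suc m))"
  shows "subdifferential (Suc m) (dir_slice R (Suc (Suc m)) g x l) (0\<^sub>v (Suc m))
    = (\<lambda>v. proj_mat R (Suc (Suc m)) l *\<^sub>v v) ` support_face l (subdifferential (Suc (Suc m)) g x)"
  unfolding subdifferential_slice[OF sublinear_dir_deriv[OF g x] l complement_proj_proj_mat[OF R l]]
    support_face_def support_fun_subdifferential[OF R g x l]
  unfolding subdifferential_eq_minorants[OF g x] ..

text \<open>The projection does not increase the norm, by Pythagoras. The same \<open>K\<close>
  serves for all \<open>l\<close>, which later yields uniform boundedness over the sphere.\<close>

lemma subdifferential_dir_slice_bounded: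
  assumes R: "rotation_family R" and g: "convex_fun (Suc (Suc m)) g"
    and x: "x \<in> carrier_vec (Suc (Suc m))" and l: "l \<in> unit_sphere (Suc (Suc m))"
    and K: "\<forall>s\<in>subdifferential (Suc (Suc m)) g x. euclid_norm s \<le> K"
  shows "\<forall>s\<in>subdifferential (Suc m) (dir_slice R (Suc (Suc m)) g x l) (0\<^sub>v (Suc m)).
    euclid_norm s \<le> K"
proof -
  let ?P = "proj_mat R (Suc (Suc m)) l"
  have P: "?P \<in> carrier_mat (Suc m) (Suc (Suc m))" by (rule proj_mat_carrier[OF R l])
  have lc: "l \<in> carrier_vec (Suc (Suc m))" using unit_sphereD[OF l] by simp
  have "euclid_norm (?P *\<^sub>v s) \<le> euclid_norm s" if s: "s \<in> carrier_vec (Suc (Suc m))" for s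
  proof -
    have Ps: "?P *\<^sub>v s \<in> carrier_vec (Suc m)" using P s by simp
    have PPs: "transpose_mat ?P *\<^sub>v (?P *\<^sub>v s) \<in> carrier_vec (Suc (Suc m))" using P Ps by simp
    have "s \<bullet> s = (transpose_mat ?P *\<^sub>v (?P *\<^sub>v s) + (l \<bullet> s) \<cdot>\<^sub>v l) \<bullet> s"
      using complement_proj_proj_mat[OF R l] s by (simp add: complement_proj_def)
    also have "\<dots> = (transpose_mat ?P *\<^sub>v (?P *\<^sub>v s)) \<bullet> s + (l \<bullet> s) * (l \<bullet> s)"
      using s lc PPs by (simp add: add_scalar_prod_distrib[of _ "Suc (Suc m)"])
    also have "(transpose_mat ?P *\<^sub>v (?P *\<^sub>v s)) \<bullet> s = (?P *\<^sub>v s) \<bullet> (?P *\<^sub>v s)"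
      by (rule transpose_vec_mult_scalar[OF P s Ps])
    finally show ?thesis by (simp add: euclid_norm_def)
  qed
  then show ?thesis
    unfolding subdifferential_dir_slice[OF R g x l]
    using K by (fastforce simp: support_face_def subdifferential_def)
qed

text \<open>Both end points of the interval are attained, by subgradients for the directions 1 and
  -1. The sign in front of \<open>INF\<close> matches the direction -1.\<close>

lemma directed_embedding_subdifferential_1:
  assumes R: "rotation_family R" and g: "convex_fun (Suc 0) g" and x: "x \<in> carrier_vec (Suc 0)"
  shows "directed_embedding R (Suc 0) (subdifferential (Suc 0) g x)
    = Directed1 (dir_deriv g x (vec 1 (\<lambda>_. -1))) (dir_deriv g x (vec 1 (\<lambda>_. 1)))"
proof -
  let ?C = "subdifferential (Suc 0) g x"
  let ?u = "vec 1 (\<lambda>_. 1) :: real vec" and ?w = "vec 1 (\<lambda>_. -1) :: real vec"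
  have sphere: "?u \<in> unit_sphere (Suc 0)" "?w \<in> unit_sphere (Suc 0)"
    by (auto simp: unit_sphere_def euclid_norm_def scalar_prod_def)
  have prods: "?u \<bullet> s = s $ 0" "?w \<bullet> s = - s $ 0" if "s \<in> ?C" for s
    using that by (auto simp: subdifferential_def scalar_prod_def)
  have le: "s $ 0 \<le> dir_deriv g x ?u" "- s $ 0 \<le> dir_deriv g x ?w" if "s \<in> ?C" for s
    using scalar_prod_le_dir_deriv[OF g x that, of ?u] scalar_prod_le_dir_deriv[OF g x that, of ?w]
      prods[OF that] by auto
  obtain s where "s \<in> ?C" "?u \<bullet> s = dir_deriv g x ?u"
    by (rule subdifferential_attains_dir_deriv[OF R g x sphere(1)])
  then have "(SUP v\<in>?C. v $ 0) = dir_deriv g x ?u"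
    using le prods by (intro cSup_eq_maximum) force+
  moreover obtain r where "r \<in> ?C" "?w \<bullet> r = dir_deriv g x ?w"
    by (rule subdifferential_attains_dir_deriv[OF R g x sphere(2)])
  then have "(INF v\<in>?C. v $ 0) = - dir_deriv g x ?w"
    using le prods by (intro cInf_eq_minimum) force+
  ultimately show ?thesis by simp
qed

lemma directed_embedding_subdifferential_Suc:
  assumes R: "rotation_family R" and g: "convex_fun (Suc (Suc m)) g"
    and x: "x \<in> carrier_vec (Suc (Suc m))"
  shows "directed_embedding R (Suc (Suc m)) (subdifferential (Suc (Suc m)) g x)
    = Directed
       (\<lambda>l\<in>unit_sphere (Suc (Suc m)). directed_embedding R (Suc m)
          (subdifferential (Suc m) (dir_slice R (Suc (Suc m)) g x l) (0\<^sub>v (Suc m))))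
       (\<lambda>l\<in>unit_sphere (Suc (Suc m)). dir_deriv g x l)"
  by (auto simp: subdifferential_dir_slice[OF R g x] support_fun_subdifferential[OF R g x]
      intro!: restrict_ext)

section \<open>Differences of embedded subdifferentials\<close>

definition subdiff_difference ::
  "(nat \<Rightarrow> real vec \<Rightarrow> real mat) \<Rightarrow> nat \<Rightarrow> (real vec \<Rightarrow> real) \<Rightarrow> (real vec \<Rightarrow> real) \<Rightarrow> real vec
    \<Rightarrow> directed" where
  "subdiff_difference R n g h x =
     directed_minus n (directed_embedding R n (subdifferential n g x))
       (directed_embedding R n (subdifferential n h x))"

lemma subdiff_difference_1:
  assumes R: "rotation_family R" and dc: "dc_decomposition (Suc 0) f g h"
    and x: "x \<in> carrier_vec (Suc 0)"
  shows "subdiff_difference R (Suc 0) g h x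
    = Directed1 (dir_deriv f x (vec 1 (\<lambda>_. -1))) (dir_deriv f x (vec 1 (\<lambda>_. 1)))"
proof -
  have "convex_fun (Suc 0) g" "convex_fun (Suc 0) h"
    using dc by (auto simp: dc_decomposition_def)
  then show ?thesis
    by (simp add: subdiff_difference_def directed_embedding_subdifferential_1[OF R _ x]
        dir_deriv_dc[OF dc x] del: directed_embedding.simps)
qed

lemma subdiff_difference_Suc:
  assumes R: "rotation_family R" and dc: "dc_decomposition (Suc (Suc m)) f g h"
    and x: "x \<in> carrier_vec (Suc (Suc m))"
  shows "subdiff_difference R (Suc (Suc m)) g h x
    = Directed
       (\<lambda>l\<in>unit_sphere (Suc (Suc m)). subdiff_difference R (Suc m)
          (dir_slice R (Suc (Suc m)) g x l) (dir_slice R (Suc (Suc m)) h x l) (0\<^sub>v (Suc m)))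
       (\<lambda>l\<in>unit_sphere (Suc (Suc m)). dir_deriv f x l)"
proof -
  have "convex_fun (Suc (Suc m)) g" "convex_fun (Suc (Suc m)) h"
    using dc by (auto simp: dc_decomposition_def)
  then show ?thesis
    unfolding subdiff_difference_def
    by (auto simp: directed_embedding_subdifferential_Suc[OF R _ x] dir_deriv_dc[OF dc x]
        unit_sphereD(1) simp del: directed_embedding.simps intro!: restrict_ext)
qed

text \<open>The scalar components involve \<open>f\<close> alone. The induction generalises over all
  functions, so that its hypothesis applies to the slices of both decompositions.\<close>

lemma subdiff_difference_unique:
  assumes R: "rotation_family R"
  shows "dc_decomposition (Suc m) f g h \<Longrightarrow> dc_decomposition (Suc m) f g' h' \<Longrightarrow>
    x \<in> carrier_vec (Suc m) \<Longrightarrow>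
    subdiff_difference R (Suc m) g h x = subdiff_difference R (Suc m) g' h' x"
proof (induction m arbitrary: f g h g' h' x)
  case 0
  then show ?case by (simp add: subdiff_difference_1[OF R])
next
  case (Suc m)
  show ?case
    unfolding subdiff_difference_Suc[OF R Suc.prems(1,3)] subdiff_difference_Suc[OF R Suc.prems(2,3)]
    by (auto intro!: restrict_ext Suc.IH dc_decomposition_dir_slice[OF R _ Suc.prems(3)] Suc.prems)
qed

text \<open>The norm bound strengthens the induction, since membership one dimension higher asks for
  uniformly bounded components. Here \<open>K\<close> stays fixed, and the factor 2 comes from the
  triangle inequality for the difference.\<close>

lemma subdiff_difference_directed_set:
  assumes R: "rotation_family R"
  shows "dc_decomposition (Suc m) f g h \<Longrightarrow> x \<in> carrier_vec (Suc m) \<Longrightarrow>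
    \<forall>s\<in>subdifferential (Suc m) g x. euclid_norm s \<le> K \<Longrightarrow>
    \<forall>s\<in>subdifferential (Suc m) h x. euclid_norm s \<le> K \<Longrightarrow>
    subdiff_difference R (Suc m) g h x \<in> directed_sets (Suc m) \<and>
    directed_norm (Suc m) (subdiff_difference R (Suc m) g h x) \<le> 2 * K"
proof (induction m arbitrary: f g h x)
  case (0 f g h x)
  have gh: "convex_fun (Suc 0) g" "convex_fun (Suc 0) h"
    using 0 by (auto simp: dc_decomposition_def)
  have "\<bar>dir_deriv f x l\<bar> \<le> 2 * K" if l: "l \<in> unit_sphere (Suc 0)" for l
    using abs_dir_deriv_le[OF R gh(1) 0(2,3) l] abs_dir_deriv_le[OF R gh(2) 0(2,4) l]
      dir_deriv_dc[OF 0(1,2)] unit_sphereD(1)[OF l] by simp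
  moreover have "vec 1 (\<lambda>_. 1) \<in> unit_sphere (Suc 0)" "vec 1 (\<lambda>_. -1) \<in> unit_sphere (Suc 0)"
    by (auto simp: unit_sphere_def euclid_norm_def scalar_prod_def)
  ultimately show ?case by (simp add: subdiff_difference_1[OF R 0(1,2)])
next
  case (Suc m f g h x)
  let ?n = "Suc (Suc m)"
  let ?S = "unit_sphere ?n"
  let ?d = "\<lambda>l. subdiff_difference R (Suc m) (dir_slice R ?n g x l) (dir_slice R ?n h x l)
    (0\<^sub>v (Suc m))"
  have gh: "convex_fun ?n g" "convex_fun ?n h"
    using Suc by (auto simp: dc_decomposition_def)
  note x = Suc.prems(2)
  have d: "?d l \<in> directed_sets (Suc m) \<and> directed_norm (Suc m) (?d l) \<le> 2 * K"
    if l: "l \<in> ?S" for l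
    using subdifferential_dir_slice_bounded[OF R gh(1) x l Suc.prems(3)]
      subdifferential_dir_slice_bounded[OF R gh(2) x l Suc.prems(4)]
    by (intro Suc.IH[OF dc_decomposition_dir_slice[OF R Suc.prems(1) x l]]) auto
  have a: "\<bar>dir_deriv f x l\<bar> \<le> 2 * K" if l: "l \<in> ?S" for l
    using abs_dir_deriv_le[OF R gh(1) x Suc.prems(3) l] abs_dir_deriv_le[OF R gh(2) x Suc.prems(4) l]
      dir_deriv_dc[OF Suc.prems(1,2)] unit_sphereD(1)[OF l] by simp
  have "(\<lambda>l\<in>?S. dir_deriv f x l) = (\<lambda>l\<in>?S. dir_deriv g x l - dir_deriv h x l)"
    using unit_sphereD(1) by (intro restrict_ext dir_deriv_dc[OF Suc.prems(1,2)])
  then have cont: "continuous_on_sphere ?n (\<lambda>l\<in>?S. dir_deriv f x l)"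
    using continuous_on_sphere_diff[OF continuous_on_sphere_dir_deriv[OF R gh(1) x]
        continuous_on_sphere_dir_deriv[OF R gh(2) x]] by simp
  \<comment> \<open>Needed to bound the suprema in \<open>directed_norm\<close>, which are
    unspecified over an empty set.\<close>
  have ne: "?S \<noteq> {}" using unit_vec_in_unit_sphere[of 0 ?n] by auto
  have "(SUP l\<in>?S. directed_norm (Suc m) (?d l)) \<le> 2 * K" "(SUP l\<in>?S. \<bar>dir_deriv f x l\<bar>) \<le> 2 * K"
    using d a ne by (auto intro!: cSUP_least)
  moreover have "bdd_above ((\<lambda>l. directed_norm (Suc m) (?d l)) ` ?S)"
    using d by (intro bdd_aboveI[of _ "2 * K"]) auto
  ultimately show ?case
    using d cont by (simp add: subdiff_difference_Suc[OF R Suc.prems(1,2)] cong: image_cong_simp)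
qed

text \<open>Makes the definite description usable: boundedness of both subdifferentials gives
  membership in \<open>directed_sets\<close>, and \<open>subdiff_difference_unique\<close> gives
  uniqueness.\<close>

lemma dc_directed_subdiff_eq:
  assumes R: "rotation_family R" and dc: "dc_decomposition (Suc m) f g h"
    and x: "x \<in> carrier_vec (Suc m)"
  shows "dc_directed_subdiff R (Suc m) f x = subdiff_difference R (Suc m) g h x"
proof -
  have "convex_fun (Suc m) g" "convex_fun (Suc m) h"
    using dc by (auto simp: dc_decomposition_def)
  then obtain K L where "\<forall>s\<in>subdifferential (Suc m) g x. euclid_norm s \<le> K"
    "\<forall>s\<in>subdifferential (Suc m) h x. euclid_norm s \<le> L"
    using subdifferential_bounded x by meson
  then have "\<forall>s\<in>subdifferential (Suc m) g x. euclid_norm s \<le> max K L"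
    "\<forall>s\<in>subdifferential (Suc m) h x. euclid_norm s \<le> max K L"
    by auto
  then have "subdiff_difference R (Suc m) g h x \<in> directed_sets (Suc m)"
    using subdiff_difference_directed_set[OF R dc x] by blast
  then show ?thesis
    unfolding dc_directed_subdiff_def subdiff_difference_def[symmetric]
    using dc subdiff_difference_unique[OF R _ _ x] by (intro the_equality) blast+
qed

theorem theorem4p1:
  fixes R :: "nat \<Rightarrow> real vec \<Rightarrow> real mat"
    and n :: nat
    and f :: "real vec \<Rightarrow> real"
    and x :: "real vec"
  assumes "rotation_family R"
    and "n \<ge> 1"
    and "dc_fun n f"
    and "x \<in> carrier_vec n"
  shows "dc_directed_subdiff R n f x =
    (if n = 1
     then Directed1 (dir_deriv f x (vec 1 (\<lambda>_. -1))) (dir_deriv f x (vec 1 (\<lambda>_. 1)))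
     else Directed
       (\<lambda>l\<in>unit_sphere n.
          dc_directed_subdiff R (n - 1)
            (\<lambda>y. dir_deriv f x (l + transpose_mat (proj_mat R n l) *\<^sub>v y)) (0\<^sub>v (n - 1)))
       (\<lambda>l\<in>unit_sphere n. dir_deriv f x l))"
proof -
  note R = assms(1)
  obtain g h where dc: "dc_decomposition n f g h" using assms(3) by (auto simp: dc_fun_def)
  consider "n = Suc 0" | m where "n = Suc (Suc m)"
    using assms(2) by (metis One_nat_def Suc_le_D not0_implies_Suc)
  then show ?thesis
  proof cases
    case 1
    then show ?thesis
      using dc assms(4) by (simp add: dc_directed_subdiff_eq[OF R] subdiff_difference_1[OF R])
  next
    case (2 m)
    note dc = dc[unfolded 2] and x = assms(4)[unfolded 2]
    \<comment> \<open>The sliced decompositions evaluate the inner directed subdifferentials of the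
      slices of \<open>f\<close>, which are exactly the components of the recursion.\<close>
    show ?thesis
      unfolding 2 dc_directed_subdiff_eq[OF R dc x] subdiff_difference_Suc[OF R dc x]
      by (auto simp: dc_directed_subdiff_eq[OF R dc_decomposition_dir_slice[OF R dc x]]
          intro!: restrict_ext)
  qed
qed

end
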